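(* Let $w\in S_n$ be a boolean permutation. Then $$\mathrm{Row}_2(P(w))=\{\, i+1 \mid i \text{ is the leftmost entry in a run of } \mathrm{canon}(w)\,\}$$ and $$\mathrm{Row}_2(Q(w))=\{\, i+1 \mid i \text{ is the rightmost entry in a run of } \mathrm{canon}(w)\,\}.$$
   Context: Permutations $w\in S_n$ are written in one-line notation $w(1)\cdots w(n)$; $s_i$ is the adjacent transposition swapping $i$ and $i+1$; products are compositions of functions, $(uv)(i)=u(v(i))$. A word $i_1\cdots i_\ell$ is a reduced word of $w$ if $w=s_{i_1}\cdots s_{i_\ell}$ with $\ell$ minimal; $[i_1\cdots i_\ell]$ denotes both this word and the permutation $s_{i_1}\cdots s_{i_\ell}$. A permutation is boolean if some (equivalently, every) reduced word of it consists of distinct letters. Equivalently, it avoids the patterns $321$ and $3412$. A run is an increasing or decreasing sequence of consecutive integers (a single letter is a run). The canonical reduced word $\mathrm{canon}(w)$ of a boolean permutation $w$, together with its decomposition into runs, is defined recursively. If $w$ is the identity, $\mathrm{canon}(w)$ is empty and has no runs. Otherwise choose any reduced word $[s]$ of $w$ (the outcome does not depend on the choice) and let $a$ be the smallest letter of $s$. (a) If $a+1$ does not appear in $s$, define $w'$ by $w=[a]\,w'$ and put $\mathrm{canon}(w)=a\cdot\mathrm{canon}(w')$. (b) If $a+1$ appears to the left of $a$ in $s$, let $b\ge a+1$ be the largest integer such that $b(b-1)\cdots a$ is a subsequence of $s$; define $w'$ by $w=[b(b-1)\cdots a]\,w'$ and put $\mathrm{canon}(w)=b(b-1)\cdots a\cdot\mathrm{canon}(w')$.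 (c) If $a+1$ appears to the right of $a$ in $s$, let $b\ge a+1$ be the largest integer such that $a(a+1)\cdots b$ is a subsequence of $s$; define $w'$ by $w=w'\,[a(a+1)\cdots b]$ and put $\mathrm{canon}(w)=\mathrm{canon}(w')\cdot a(a+1)\cdots b$. In each case the runs of $\mathrm{canon}(w)$ are the displayed run together with the runs of $\mathrm{canon}(w')$. $P(w)$ and $Q(w)$ are the insertion and recording tableaux of $w$ under the Robinson–Schensted–Knuth (row insertion) correspondence, and $\mathrm{Row}_2(T)$ is the set of entries in the second row of the tableau $T$ (empty if $T$ has only one row). *)

theory Defs
  imports "HOL-Combinatorics.Permutations" "HOL-Library.Sublist"
begin

section \<open>Reduced words and boolean permutations\<close>

text \<open>
  An element of $S_n$ is a function \<open>w\<close> with \<open>w permutes {1..n}\<close>, so \<open>u \<circ> v\<close> is the product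
  $uv$. A word \<open>s\<close> over the letters $1, \ldots, n-1$ stands for the permutation \<open>word_perm s\<close>.
\<close>

fun word_perm :: "nat list \<Rightarrow> nat \<Rightarrow> nat" where
  "word_perm [] = id"
| "word_perm (i # s) = transpose i (Suc i) \<circ> word_perm s"

definition is_word :: "nat \<Rightarrow> (nat \<Rightarrow> nat) \<Rightarrow> nat list \<Rightarrow> bool" where
  "is_word n w s \<longleftrightarrow> set s \<subseteq> {1..<n} \<and> word_perm s = w"

definition reduced_word :: "nat \<Rightarrow> (nat \<Rightarrow> nat) \<Rightarrow> nat list \<Rightarrow> bool" where
  "reduced_word n w s \<longleftrightarrow> is_word n w s \<and> (\<forall>t. is_word n w t \<longrightarrow> length s \<le> length t)"

definition boolean_perm :: "nat \<Rightarrow> (nat \<Rightarrow> nat) \<Rightarrow> bool" where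
  "boolean_perm n w \<longleftrightarrow> (\<exists>s. reduced_word n w s \<and> distinct s)"


section \<open>The canonical reduced word\<close>

text \<open>
  \<open>canon_decomp n w rs\<close>: some sequence of choices of reduced words in the recursion produces the
  canonical word \<open>concat rs\<close> of \<open>w\<close>, with list of runs \<open>rs\<close> (in order from left to right).
  The letters of a reduced word of a boolean permutation are distinct, so
  \<open>subseq [a + 1, a] s\<close> says that \<open>a + 1\<close> appears to the left of \<open>a\<close> in \<open>s\<close>.
\<close>

inductive canon_decomp :: "nat \<Rightarrow> (nat \<Rightarrow> nat) \<Rightarrow> nat list list \<Rightarrow> bool" for n where
  identity: "canon_decomp n id []"
| single:
    "w \<noteq> id \<Longrightarrow> reduced_word n w s \<Longrightarrow> a = Min (set s) \<Longrightarrow>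
     a + 1 \<notin> set s \<Longrightarrow>
     w = word_perm [a] \<circ> w' \<Longrightarrow> canon_decomp n w' rs \<Longrightarrow>
     canon_decomp n w ([a] # rs)"
| decreasing:
    "w \<noteq> id \<Longrightarrow> reduced_word n w s \<Longrightarrow> a = Min (set s) \<Longrightarrow>
     subseq [a + 1, a] s \<Longrightarrow>
     b = (GREATEST b. a + 1 \<le> b \<and> subseq (rev [a..<b + 1]) s) \<Longrightarrow>
     w = word_perm (rev [a..<b + 1]) \<circ> w' \<Longrightarrow> canon_decomp n w' rs \<Longrightarrow>
     canon_decomp n w (rev [a..<b + 1] # rs)"
| increasing:
    "w \<noteq> id \<Longrightarrow> reduced_word n w s \<Longrightarrow> a = Min (set s) \<Longrightarrow>
     subseq [a, a + 1] s \<Longrightarrow>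
     b = (GREATEST b. a + 1 \<le> b \<and> subseq [a..<b + 1] s) \<Longrightarrow>
     w = w' \<circ> word_perm [a..<b + 1] \<Longrightarrow> canon_decomp n w' rs \<Longrightarrow>
     canon_decomp n w (rs @ [[a..<b + 1]])"

text \<open>
  The runs of the canonical reduced word. For boolean \<open>w\<close> the decomposition exists and does not
  depend on the choices; this is \<open>canon_decomp_ex1\<close> below.
\<close>

definition canon_runs :: "nat \<Rightarrow> (nat \<Rightarrow> nat) \<Rightarrow> nat list list" where
  "canon_runs n w = (THE rs. canon_decomp n w rs)"


section \<open>Robinson--Schensted--Knuth\<close>

text \<open>Tableaux are lists of rows, top row first, each row read from left to right.\<close>

type_synonym tableau = "nat list list"

text \<open>The second component is the bumped entry, if any.\<close>

fun row_insert :: "nat \<Rightarrow> nat list \<Rightarrow> nat list \<times> nat option" where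
  "row_insert x [] = ([x], None)"
| "row_insert x (y # ys) =
     (if x < y then (x # ys, Some y)
      else let (ys', bumped) = row_insert x ys in (y # ys', bumped))"

text \<open>The second component is the index, counted from 0, of the row that gains a box.\<close>

fun tab_insert :: "nat \<Rightarrow> tableau \<Rightarrow> tableau \<times> nat" where
  "tab_insert x [] = ([[x]], 0)"
| "tab_insert x (r # rs) =
     (case row_insert x r of
        (r', None) \<Rightarrow> (r' # rs, 0)
      | (r', Some y) \<Rightarrow> (let (rs', k) = tab_insert y rs in (r' # rs', Suc k)))"

definition append_to_row :: "nat \<Rightarrow> nat \<Rightarrow> tableau \<Rightarrow> tableau" where
  "append_to_row k x T = (if k < length T then T[k := T ! k @ [x]] else T @ [[x]])"

definition rsk_step :: "nat \<times> nat \<Rightarrow> tableau \<times> tableau \<Rightarrow> tableau \<times> tableau" where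
  "rsk_step = (\<lambda>(j, x) (P, Q). let (P', k) = tab_insert x P in (P', append_to_row k j Q))"

definition rsk :: "nat list \<Rightarrow> tableau \<times> tableau" where
  "rsk xs = fold rsk_step (zip [1..<length xs + 1] xs) ([], [])"

definition one_line :: "nat \<Rightarrow> (nat \<Rightarrow> nat) \<Rightarrow> nat list" where
  "one_line n w = map w [1..<n + 1]"

definition P_tableau :: "nat \<Rightarrow> (nat \<Rightarrow> nat) \<Rightarrow> tableau" where
  "P_tableau n w = fst (rsk (one_line n w))"

definition Q_tableau :: "nat \<Rightarrow> (nat \<Rightarrow> nat) \<Rightarrow> tableau" where
  "Q_tableau n w = snd (rsk (one_line n w))"

definition Row2 :: "tableau \<Rightarrow> nat set" where
  "Row2 T = (if 2 \<le> length T then set (T ! 1) else {})"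


section \<open>The canonical decomposition is well defined\<close>

lemma word_perm_append: "word_perm (s @ t) = word_perm s \<circ> word_perm t"
  by (induction s) (auto simp: o_assoc)

lemma word_perm_rev: "word_perm (rev s) \<circ> word_perm s = id"
proof (induction s)
  case (Cons i s)
  have "word_perm (rev (i # s)) \<circ> word_perm (i # s) =
      word_perm (rev s) \<circ> (transpose i (Suc i) \<circ> transpose i (Suc i)) \<circ> word_perm s"
    by (simp only: word_perm_append o_assoc rev.simps word_perm.simps comp_id)
  then show ?case using Cons by (simp only: transpose_comp_involutory comp_id)
qed simp

lemma word_perm_rev': "word_perm s \<circ> word_perm (rev s) = id"
  using word_perm_rev[of "rev s"] by simp

lemma word_perm_cancel_left: "word_perm s \<circ> f = word_perm s \<circ> g \<Longrightarrow> f = g"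
  by (metis comp_assoc id_comp word_perm_rev)

lemma word_perm_cancel_right: "f \<circ> word_perm s = g \<circ> word_perm s \<Longrightarrow> f = g"
  by (metis comp_assoc comp_id word_perm_rev')

lemma word_perm_fix: "i \<notin> set s \<Longrightarrow> i - 1 \<notin> set s \<Longrightarrow> word_perm s i = i"
  by (induction s) (auto simp: transpose_def)

lemma word_perm_transpose_commute:
  assumes "x \<notin> set u" "Suc x \<notin> set u" "x - 1 \<notin> set u"
  shows "transpose x (Suc x) \<circ> word_perm u = word_perm u \<circ> transpose x (Suc x)"
  using assms
proof (induction u)
  case (Cons y u)
  have "transpose x (Suc x) \<circ> transpose y (Suc y) = transpose y (Suc y) \<circ> transpose x (Suc x)"
    using Cons.prems by (auto simp: transpose_def fun_eq_iff)
  then show ?case using Cons by (metis comp_assoc list.set_intros(2) word_perm.simps(2))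
qed simp

lemma word_perm_to_front:
  assumes "x \<notin> set u" "Suc x \<notin> set u" "x - 1 \<notin> set u"
  shows "word_perm (u @ x # v) = transpose x (Suc x) \<circ> word_perm (u @ v)"
  using word_perm_transpose_commute[OF assms] by (simp add: word_perm_append o_assoc)

lemma subseq_revI: "subseq xs ys \<Longrightarrow> subseq (rev xs) (rev ys)"
  by (induction rule: list_emb.induct) (auto intro: list_emb_append_mono subseq_rev_drop_many)

lemma subseq_rev: "subseq (rev xs) (rev ys) \<longleftrightarrow> subseq xs ys"
  using subseq_revI[of xs ys] subseq_revI[of "rev xs" "rev ys"] by auto

lemma extract_decreasing:
  assumes "a \<le> b" "distinct s" "\<forall>x\<in>set s. a \<le> x" "subseq (rev [a..<Suc b]) s"
    "\<not> subseq [Suc b, b] s" "0 < a"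
  shows "\<exists>t. word_perm s = word_perm (rev [a..<Suc b]) \<circ> word_perm t \<and>
     distinct t \<and> set t = set s - {a..b}"
  using assms
proof (induction b arbitrary: s rule: dec_induct)
  case base
  then have "subseq [a] s" by simp
  then have "a \<in> set s" by (simp add: subseq_singleton_left)
  then obtain u v where s: "s = u @ a # v" by (meson split_list)
  have "Suc a \<notin> set u"
  proof
    assume "Suc a \<in> set u"
    then have "subseq [Suc a] u" by (simp add: subseq_singleton_left)
    then have "subseq ([Suc a] @ [a]) (u @ a # v)"
      by (intro list_emb_append_mono) auto
    then show False using base s by simp
  qed
  moreover have "a - 1 \<notin> set u"
  proof
    assume "a - 1 \<in> set u"
    then have "a \<le> a - 1" using base.prems(2) s by simp
    then show False using base.prems(5) by simp
  qed
  moreover have "a \<notin> set u" using base s by simp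
  ultimately have "word_perm s = transpose a (Suc a) \<circ> word_perm (u @ v)"
    using s word_perm_to_front by blast
  then show ?case using base s by (intro exI[of _ "u @ v"]) auto
next
  case (step b)
  have sub: "subseq (Suc b # rev [a..<Suc b]) s" using step by simp
  then obtain u v where s: "s = u @ Suc b # v" and sv: "subseq (rev [a..<Suc b]) v"
    by (auto dest: list_emb_ConsD)
  have mem: "b \<in> set v"
    using list_emb_set[OF sv, of b] step.hyps by auto
  have "Suc (Suc b) \<notin> set u"
  proof
    assume "Suc (Suc b) \<in> set u"
    then have "subseq [Suc (Suc b)] u" by (simp add: subseq_singleton_left)
    then have "subseq ([Suc (Suc b)] @ [Suc b]) (u @ Suc b # v)"
      by (intro list_emb_append_mono) auto
    then show False using step.prems s by simp
  qed
  moreover have "Suc b - 1 \<notin> set u" using mem step.prems s by auto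
  moreover have "Suc b \<notin> set u" using step.prems s by simp
  ultimately have eq: "word_perm s = transpose (Suc b) (Suc (Suc b)) \<circ> word_perm (u @ v)"
    using s word_perm_to_front by blast
  have "\<exists>t. word_perm (u @ v) = word_perm (rev [a..<Suc b]) \<circ> word_perm t \<and>
     distinct t \<and> set t = set (u @ v) - {a..b}"
  proof (rule step.IH)
    show "subseq (rev [a..<Suc b]) (u @ v)" using sv by (rule list_emb_append2)
    show "\<not> subseq [Suc b, b] (u @ v)"
    proof
      assume "subseq [Suc b, b] (u @ v)"
      from list_emb_set[OF this, of "Suc b"] have "Suc b \<in> set (u @ v)" by auto
      then show False using step.prems s by auto
    qed
  qed (use step.prems s in auto)
  then obtain t where t: "word_perm (u @ v) = word_perm (rev [a..<Suc b]) \<circ> word_perm t"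
    "distinct t" "set t = set (u @ v) - {a..b}" by blast
  have "word_perm s = word_perm (rev [a..<Suc (Suc b)]) \<circ> word_perm t"
    using eq t step.hyps by (simp add: o_assoc)
  moreover have "set t = set s - {a..Suc b}"
    using t s step.prems step.hyps by (auto simp: le_Suc_eq)
  ultimately show ?case using t by blast
qed

lemma extract_increasing:
  assumes "a \<le> b" "distinct s" "\<forall>x\<in>set s. a \<le> x" "subseq [a..<Suc b] s"
    "\<not> subseq [b, Suc b] s" "0 < a"
  shows "\<exists>t. word_perm s = word_perm t \<circ> word_perm [a..<Suc b] \<and>
     distinct t \<and> set t = set s - {a..b}"
proof -
  have "subseq (rev [a..<Suc b]) (rev s)" using assms(4) by (simp only: subseq_rev)
  moreover have "\<not> subseq [Suc b, b] (rev s)"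
    using assms(5) subseq_rev[of "[b, Suc b]" s] by simp
  ultimately obtain t where t: "word_perm (rev s) = word_perm (rev [a..<Suc b]) \<circ> word_perm t"
    "distinct t" "set t = set s - {a..b}"
    using extract_decreasing[of a b "rev s"] assms by auto
  have "word_perm (rev s) \<circ> word_perm s = word_perm (rev s) \<circ> (word_perm (rev t) \<circ> word_perm [a..<Suc b])"
  proof -
    have "word_perm (rev s) \<circ> (word_perm (rev t) \<circ> word_perm [a..<Suc b]) =
       word_perm (rev [a..<Suc b]) \<circ> (word_perm t \<circ> word_perm (rev t)) \<circ> word_perm [a..<Suc b]"
      unfolding t(1) by (simp only: o_assoc)
    also have "\<dots> = id" by (simp only: word_perm_rev' comp_id word_perm_rev)
    finally show ?thesis by (simp only: word_perm_rev)
  qed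
  then have "word_perm s = word_perm (rev t) \<circ> word_perm [a..<Suc b]"
    by (rule word_perm_cancel_left)
  then show ?thesis using t by (intro exI[of _ "rev t"]) simp
qed

text \<open>The letters of a word without repetitions occur in every word for the same permutation.\<close>

lemma word_perm_le: "i \<notin> set s \<Longrightarrow> word_perm s x \<le> i \<longleftrightarrow> x \<le> i"
proof (induction s arbitrary: x)
  case (Cons j s)
  have "j \<noteq> i" using Cons.prems by auto
  then have "transpose j (Suc j) y \<le> i \<longleftrightarrow> y \<le> i" for y by (auto simp: transpose_def)
  then show ?case using Cons by simp
qed simp

lemma letters_subset:
  assumes "distinct s" "word_perm s = word_perm t"
  shows "set s \<subseteq> set t"
proof
  fix i assume "i \<in> set s"
  then obtain u v where s: "s = u @ i # v" by (meson split_list)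
  have iu: "i \<notin> set u" "i \<notin> set v" using assms s by auto
  show "i \<in> set t"
  proof (rule ccontr)
    assume it: "i \<notin> set t"
    define x where "x = word_perm (rev v) i"
    have vx: "word_perm v x = i" using word_perm_rev'[of v] unfolding x_def by (metis comp_apply id_apply)
    have "x \<le> i" using word_perm_le[OF iu(2), of x] vx by simp
    then have "word_perm s x \<le> i" using it assms word_perm_le by metis
    moreover have "word_perm s x = word_perm u (Suc i)" using s vx by (simp add: word_perm_append)
    ultimately show False using word_perm_le[OF iu(1), of "Suc i"] by simp
  qed
qed

lemma reduced_word_distinct:
  assumes "boolean_perm n w" "reduced_word n w s"
  shows "distinct s"
proof -
  obtain t where t: "reduced_word n w t" "distinct t" using assms by (auto simp: boolean_perm_def)
  have len: "length s = length t" using assms t by (auto simp: reduced_word_def intro: le_antisym)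
  have "set t \<subseteq> set s" using letters_subset t assms by (simp add: reduced_word_def is_word_def)
  then have "card (set t) \<le> card (set s)" by (simp add: card_mono)
  then have "length s \<le> card (set s)" using t len by (simp add: distinct_card)
  then show ?thesis by (meson card_distinct card_length le_antisym)
qed

lemma distinct_word_reduced:
  assumes "is_word n w s" "distinct s"
  shows "reduced_word n w s"
  unfolding reduced_word_def
proof (intro conjI allI impI assms(1))
  fix t assume t: "is_word n w t"
  then have "set s \<subseteq> set t" using letters_subset assms by (simp add: is_word_def)
  then have "card (set s) \<le> card (set t)" by (simp add: card_mono)
  then show "length s \<le> length t" using assms(2) card_length[of t] by (simp add: distinct_card)
qed

lemma boolean_permI: "set s \<subseteq> {1..<n} \<Longrightarrow> word_perm s = w \<Longrightarrow> distinct s \<Longrightarrow> boolean_perm n w"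
  using distinct_word_reduced by (auto simp: boolean_perm_def is_word_def)

lemma subseq_extend:
  assumes "distinct s" "subseq (y # r) s" "subseq [x, y] s"
  shows "subseq (x # y # r) s"
proof -
  obtain u v where s: "s = u @ y # v" and r: "subseq r v"
    using assms(2) by (auto dest: list_emb_ConsD)
  obtain u' v' where s': "s = u' @ x # v'" and y: "subseq [y] v'"
    using assms(3) by (auto dest: list_emb_ConsD)
  have "x \<in> set u"
  proof (rule ccontr)
    assume "x \<notin> set u"
    then have "x = y \<or> x \<in> set v" using s s' by (metis in_set_conv_decomp set_ConsD Un_iff set_append)
    moreover have "x \<noteq> y" using y assms(1) s' by (auto simp: subseq_singleton_left)
    ultimately obtain v1 v2 where "v = v1 @ x # v2" by (meson split_list)
    then have e: "(u @ y # v1) @ x # v2 = u' @ x # v'" using s s' by simp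
    have "x \<notin> set (u @ y # v1)" "x \<notin> set u'" using assms(1) s s' e
      by (metis distinct_append disjoint_iff list.set_intros(1) not_distinct_conv_prefix append_Cons append_assoc)+
    then have "u @ y # v1 = u'" using e assms(1) s'
      by (metis append_Cons_eq_iff distinct.simps(2) distinct_append)
    then have "y \<in> set u'" by auto
    then show False using y assms(1) s' by (auto simp: subseq_singleton_left)
  qed
  then have "subseq [x] u" by (simp add: subseq_singleton_left)
  then have "subseq ([x] @ y # r) (u @ y # v)" by (intro list_emb_append_mono) (auto simp: r)
  then show ?thesis using s by simp
qed

lemma greatest_decreasing:
  assumes "distinct s" "subseq [a + 1, a] s"
    "b = (GREATEST b. a + 1 \<le> b \<and> subseq (rev [a..<b + 1]) s)"
  shows "a + 1 \<le> b" "subseq (rev [a..<Suc b]) s" "\<not> subseq [Suc b, b] s"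
proof -
  let ?P = "\<lambda>b. a + 1 \<le> b \<and> subseq (rev [a..<b + 1]) s"
  have P0: "?P (a + 1)" using assms(2) by simp
  have bound: "y \<le> a + length s" if "?P y" for y
    using list_emb_length[OF conjunct2[OF that]] by (simp split: if_splits)
  have P: "?P b" unfolding assms(3) using GreatestI_nat[of ?P, OF P0 bound] by blast
  then show "a + 1 \<le> b" and sub: "subseq (rev [a..<Suc b]) s" by auto
  show "\<not> subseq [Suc b, b] s"
  proof
    assume "subseq [Suc b, b] s"
    then have "?P (Suc b)" using P subseq_extend[OF assms(1), of b "rev [a..<b]" "Suc b"] by (simp split: if_splits)
    then have "Suc b \<le> b" unfolding assms(3) using Greatest_le_nat[of ?P, OF _ bound] by blast
    then show False by simp
  qed
qed

lemma greatest_increasing: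
  assumes "distinct s" "subseq [a, a + 1] s"
    "b = (GREATEST b. a + 1 \<le> b \<and> subseq [a..<b + 1] s)"
  shows "a + 1 \<le> b" "subseq [a..<Suc b] s" "\<not> subseq [b, Suc b] s"
proof -
  have "subseq (rev [a, a + 1]) (rev s)" using assms(2) by (simp only: subseq_rev)
  then have desc: "subseq [a + 1, a] (rev s)" by simp
  have b: "b = (GREATEST b. a + 1 \<le> b \<and> subseq (rev [a..<b + 1]) (rev s))"
    using assms(3) by (simp only: subseq_rev)
  have "distinct (rev s)" using assms(1) by simp
  note * = greatest_decreasing[OF this desc b]
  show "a + 1 \<le> b" "subseq [a..<Suc b] s" using *(1,2) by (simp_all only: subseq_rev)
  show "\<not> subseq [b, Suc b] s" using *(3) subseq_rev[of "[b, Suc b]" s] by simp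
qed

lemma word_perm_decreasing_run: "a \<le> b \<Longrightarrow> word_perm (rev [a..<Suc b]) a = Suc b"
  by (induction b rule: dec_induct) (auto simp: transpose_def)

lemma word_perm_increasing_run: "a \<le> b \<Longrightarrow> word_perm [a..<Suc b] (Suc b) = a"
proof -
  assume "a \<le> b"
  then have "word_perm [a..<Suc b] (word_perm (rev [a..<Suc b]) a) = word_perm [a..<Suc b] (Suc b)"
    by (simp only: word_perm_decreasing_run)
  then show ?thesis using word_perm_rev'[of "[a..<Suc b]"] by (metis comp_apply id_apply)
qed

text \<open>
  Each of the three cases of the recursion, and its \<open>b\<close>, can be read off from \<open>w\<close> and \<open>a\<close>.
\<close>

lemma min_letter:
  assumes "w \<noteq> id" "reduced_word n w s" "a = Min (set s)"
  shows "a \<in> set s" "\<forall>x\<in>set s. a \<le> x" "0 < a" "set s \<subseteq> {1..<n}" "word_perm s = w"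
    "a - 1 \<notin> set s"
proof -
  show w: "set s \<subseteq> {1..<n}" "word_perm s = w" using assms by (auto simp: reduced_word_def is_word_def)
  have "s \<noteq> []" using w assms(1) by auto
  then show "a \<in> set s" "\<forall>x\<in>set s. a \<le> x" using assms(3) by auto
  then show "0 < a" using w by auto
  then show "a - 1 \<notin> set s" using \<open>\<forall>x\<in>set s. a \<le> x\<close> by fastforce
qed

lemma single_step:
  assumes "distinct s" "w \<noteq> id" "reduced_word n w s" "a = Min (set s)" "a + 1 \<notin> set s"
  shows "w (Suc a) = a" "\<exists>t. w = word_perm [a] \<circ> word_perm t \<and> distinct t \<and> set t = set s - {a}"
proof -
  note m = min_letter[OF assms(2-4)]
  have "subseq [a] s" using m by (simp add: subseq_singleton_left)
  moreover have "\<not> subseq [Suc a, a] s"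
    using assms(5) by (auto dest!: list_emb_set[where x = "Suc a"])
  ultimately obtain t where t: "w = word_perm [a] \<circ> word_perm t" "distinct t" "set t = set s - {a}"
    using extract_decreasing[of a a s] assms(1) m by auto
  then show "\<exists>t. w = word_perm [a] \<circ> word_perm t \<and> distinct t \<and> set t = set s - {a}" by blast
  have "word_perm t (Suc a) = Suc a" using t(3) assms(5) by (intro word_perm_fix) auto
  then show "w (Suc a) = a" using t(1) by simp
qed

lemma decreasing_step:
  assumes "distinct s" "w \<noteq> id" "reduced_word n w s" "a = Min (set s)" "subseq [a + 1, a] s"
    "b = (GREATEST b. a + 1 \<le> b \<and> subseq (rev [a..<b + 1]) s)"
  shows "a < b" "w a = Suc b"
    "\<exists>t. w = word_perm (rev [a..<Suc b]) \<circ> word_perm t \<and> distinct t \<and> set t = set s - {a..b}"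
proof -
  note m = min_letter[OF assms(2-4)] and g = greatest_decreasing[OF assms(1,5,6)]
  show "a < b" using g by simp
  then show ex: "\<exists>t. w = word_perm (rev [a..<Suc b]) \<circ> word_perm t \<and> distinct t \<and> set t = set s - {a..b}"
    using extract_decreasing[of a b s] assms(1) m g by (simp del: upt_Suc)
  then obtain t where t: "w = word_perm (rev [a..<Suc b]) \<circ> word_perm t" "set t = set s - {a..b}" by blast
  have "word_perm t a = a" using t(2) m(6) \<open>a < b\<close> by (intro word_perm_fix) auto
  then show "w a = Suc b" using t(1) \<open>a < b\<close> by (simp add: word_perm_decreasing_run del: upt_Suc)
qed

lemma increasing_step:
  assumes "distinct s" "w \<noteq> id" "reduced_word n w s" "a = Min (set s)" "subseq [a, a + 1] s"
    "b = (GREATEST b. a + 1 \<le> b \<and> subseq [a..<b + 1] s)"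
  shows "a < b" "w a = Suc a" "w (Suc b) = a"
    "\<exists>t. w = word_perm t \<circ> word_perm [a..<Suc b] \<and> distinct t \<and> set t = set s - {a..b}"
proof -
  note m = min_letter[OF assms(2-4)] and g = greatest_increasing[OF assms(1,5,6)]
  show ab: "a < b" using g by simp
  then show ex: "\<exists>t. w = word_perm t \<circ> word_perm [a..<Suc b] \<and> distinct t \<and> set t = set s - {a..b}"
    using extract_increasing[of a b s] assms(1) m g by (simp del: upt_Suc)
  then obtain t where t: "w = word_perm t \<circ> word_perm [a..<Suc b]" "set t = set s - {a..b}" by blast
  have "word_perm t a = a" using t(2) m(6) ab by (intro word_perm_fix) auto
  then show "w (Suc b) = a" using t(1) ab by (simp add: word_perm_increasing_run del: upt_Suc)
  have "word_perm [Suc a..<Suc b] a = a" using m(3) by (intro word_perm_fix) auto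
  moreover have "[a..<Suc b] = a # [Suc a..<Suc b]" using ab by (intro upt_conv_Cons) simp
  ultimately have "word_perm [a..<Suc b] a = Suc a" by (simp del: upt_Suc)
  moreover have "word_perm t (Suc a) = Suc a" using t(2) ab by (intro word_perm_fix) auto
  ultimately show "w a = Suc a" unfolding t(1) by (simp del: upt_Suc)
qed

lemma word_perm_comp_eqD: "w = word_perm r \<circ> f \<Longrightarrow> w = word_perm r \<circ> g \<Longrightarrow> f = g"
  using word_perm_cancel_left[of r f g] by simp

lemma word_perm_comp_eqD': "w = f \<circ> word_perm r \<Longrightarrow> w = g \<circ> word_perm r \<Longrightarrow> f = g"
  using word_perm_cancel_right[of f r g] by simp

lemma ascent_or_descent:
  assumes "distinct s" "x \<in> set s" "y \<in> set s" "x \<noteq> y"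
  shows "subseq [x, y] s \<or> subseq [y, x] s"
proof -
  obtain u v where s: "s = u @ x # v" using assms(2) by (meson split_list)
  show ?thesis
  proof (cases "y \<in> set u")
    case True
    then have "subseq ([y] @ [x]) (u @ x # v)"
      by (intro list_emb_append_mono) (auto simp: subseq_singleton_left)
    then show ?thesis using s by simp
  next
    case False
    then have "subseq ([] @ [x, y]) (u @ x # v)"
      using s assms by (intro list_emb_append_mono) (auto simp: subseq_singleton_left)
    then show ?thesis using s by simp
  qed
qed

lemma canon_decomp_ex:
  assumes "set s \<subseteq> {1..<n}" "distinct s"
  shows "\<exists>rs. canon_decomp n (word_perm s) rs"
  using assms
proof (induction "card (set s)" arbitrary: s rule: less_induct)
  case less
  let ?w = "word_perm s" and ?a = "Min (set s)"
  have red: "reduced_word n ?w s" using less.prems by (intro distinct_word_reduced) (auto simp: is_word_def)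
  have IH: "\<exists>rs. canon_decomp n (word_perm t) rs"
    if "distinct t" "set t = set s - A" "?a \<in> A" "?a \<in> set s" for t A
  proof (rule less.hyps)
    show "card (set t) < card (set s)" using that by (intro psubset_card_mono) auto
  qed (use that less.prems in auto)
  show ?case
  proof (cases "?w = id")
    case True
    then show ?thesis using canon_decomp.identity by metis
  next
    case False
    note m = min_letter[OF False red refl]
    consider "?a + 1 \<notin> set s" | "subseq [?a + 1, ?a] s" | "subseq [?a, ?a + 1] s"
      using ascent_or_descent[OF less.prems(2) m(1), of "?a + 1"] by auto
    then show ?thesis
    proof cases
      case 1
      obtain t where t: "?w = word_perm [?a] \<circ> word_perm t" "distinct t" "set t = set s - {?a}"
        using single_step(2)[OF less.prems(2) False red refl 1] by blast
      obtain rs where "canon_decomp n (word_perm t) rs" using IH[OF t(2,3)] m(1) by auto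
      then show ?thesis using canon_decomp.single[OF False red refl 1 t(1)] by blast
    next
      case 2
      define b where "b = (GREATEST b. ?a + 1 \<le> b \<and> subseq (rev [?a..<b + 1]) s)"
      note d = decreasing_step[OF less.prems(2) False red refl 2 b_def]
      obtain t where t: "?w = word_perm (rev [?a..<b + 1]) \<circ> word_perm t" "distinct t"
        "set t = set s - {?a..b}"
        using d(3) by (auto simp del: upt_Suc)
      obtain rs where "canon_decomp n (word_perm t) rs" using IH[OF t(2,3)] m(1) d(1) by auto
      then show ?thesis using canon_decomp.decreasing[OF False red refl 2 b_def t(1)] by blast
    next
      case 3
      define b where "b = (GREATEST b. ?a + 1 \<le> b \<and> subseq [?a..<b + 1] s)"
      note d = increasing_step[OF less.prems(2) False red refl 3 b_def]
      obtain t where t: "?w = word_perm t \<circ> word_perm [?a..<b + 1]" "distinct t"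
        "set t = set s - {?a..b}"
        using d(4) by (auto simp del: upt_Suc)
      obtain rs where "canon_decomp n (word_perm t) rs" using IH[OF t(2,3)] m(1) d(1) by auto
      then show ?thesis using canon_decomp.increasing[OF False red refl 3 b_def t(1)] by blast
    qed
  qed
qed

lemma min_letter_unique:
  assumes "boolean_perm n w" "reduced_word n w s" "reduced_word n w t"
  shows "Min (set s) = Min (set t)"
proof -
  have "set s = set t"
    using assms reduced_word_distinct[OF assms(1)] letters_subset
    by (metis is_word_def reduced_word_def subset_antisym)
  then show ?thesis by simp
qed

lemma canon_decomp_unique:
  assumes "canon_decomp n w rs" "canon_decomp n w rs'" "boolean_perm n w"
  shows "rs = rs'"
  using assms
proof (induction arbitrary: rs' rule: canon_decomp.induct)
  case identity
  from identity(1) show ?case by (cases rule: canon_decomp.cases) auto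
next
  case (single w s a w' rs)
  note h = single.hyps and IH = single.IH and bw = single.prems(2)
  note D = reduced_word_distinct[OF bw] and M = min_letter_unique[OF bw]
  note st = single_step[OF D[OF h(2)] h(1-4)]
  obtain t where t: "w = word_perm [a] \<circ> word_perm t" "distinct t" "set t = set s - {a}"
    using st(2) by blast
  have "w' = word_perm t" using word_perm_comp_eqD[OF h(5) t(1)] .
  then have bool: "boolean_perm n w'"
    using t h(2) by (intro boolean_permI[of t]) (auto simp: reduced_word_def is_word_def)
  from single.prems(1) show ?case
  proof (cases rule: canon_decomp.cases)
    case identity
    then show ?thesis using h by simp
  next
    case (single s2 a2 w2 rs2)
    have a: "a2 = a" using M[OF single(3) h(2)] single(4) h(3) by simp
    have "w2 = w'" using word_perm_comp_eqD[OF single(6)[unfolded a] h(5)] .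
    then show ?thesis using IH[OF _ bool] single a by auto
  next
    case (decreasing s2 a2 b2 w2 rs2)
    have a: "a2 = a" using M[OF decreasing(3) h(2)] decreasing(4) h(3) by simp
    note st2 = decreasing_step[OF D[OF decreasing(3)] decreasing(2-6)]
    have "word_perm t a = a" using t(3) min_letter(6)[OF h(1-3)] by (intro word_perm_fix) auto
    then have "w a = Suc a" by (simp add: t(1))
    then show ?thesis using st2 a by simp
  next
    case (increasing s2 a2 b2 w2 rs2)
    have a: "a2 = a" using M[OF increasing(3) h(2)] increasing(4) h(3) by simp
    note st2 = increasing_step[OF D[OF increasing(3)] increasing(2-6)]
    have "w (Suc a) = w (Suc b2)" using st(1) st2(3) a by simp
    then have "word_perm s (Suc a) = word_perm s (Suc b2)" using min_letter(5)[OF h(1-3)] by simp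
    then have "Suc a = Suc b2" using word_perm_rev[of s] by (metis comp_apply id_apply)
    then show ?thesis using st2(1) a by simp
  qed
next
  case (decreasing w s a b w' rs)
  note h = decreasing.hyps and IH = decreasing.IH and bw = decreasing.prems(2)
  note D = reduced_word_distinct[OF bw] and M = min_letter_unique[OF bw]
  note st = decreasing_step[OF D[OF h(2)] h(1-5)]
  obtain t where t: "w = word_perm (rev [a..<b + 1]) \<circ> word_perm t" "distinct t"
      "set t = set s - {a..b}"
    using st(3) by (auto simp del: upt_Suc)
  have "w' = word_perm t" using word_perm_comp_eqD[OF h(6) t(1)] .
  then have bool: "boolean_perm n w'"
    using t h(2) by (intro boolean_permI[of t]) (auto simp: reduced_word_def is_word_def)
  from decreasing.prems(1) show ?case
  proof (cases rule: canon_decomp.cases)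
    case identity
    then show ?thesis using h by simp
  next
    case (single s2 a2 w2 rs2)
    have a: "a2 = a" using M[OF single(3) h(2)] single(4) h(3) by simp
    obtain t2 where t2: "w = word_perm [a] \<circ> word_perm t2" "set t2 = set s2 - {a}"
      using single_step(2)[OF D[OF single(3)] single(2-5)] a by auto
    have "word_perm t2 a = a"
      using t2(2) min_letter(6)[OF single(2-4)] a by (intro word_perm_fix) auto
    then have "w a = Suc a" by (simp add: t2(1))
    then show ?thesis using st by simp
  next
    case (decreasing s2 a2 b2 w2 rs2)
    have a: "a2 = a" using M[OF decreasing(3) h(2)] decreasing(4) h(3) by simp
    have b: "b2 = b" using decreasing_step(2)[OF D[OF decreasing(3)] decreasing(2-6)] st(2) a by simp
    have "w2 = w'" using word_perm_comp_eqD[OF decreasing(7)[unfolded a b] h(6)] .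
    then show ?thesis using IH[OF _ bool] decreasing a b by auto
  next
    case (increasing s2 a2 b2 w2 rs2)
    have a: "a2 = a" using M[OF increasing(3) h(2)] increasing(4) h(3) by simp
    show ?thesis
      using increasing_step(2)[OF D[OF increasing(3)] increasing(2-6)] st a by simp
  qed
next
  case (increasing w s a b w' rs)
  note h = increasing.hyps and IH = increasing.IH and bw = increasing.prems(2)
  note D = reduced_word_distinct[OF bw] and M = min_letter_unique[OF bw]
  note st = increasing_step[OF D[OF h(2)] h(1-5)]
  have inj: "x = y" if "w x = w y" for x y
    using that min_letter(5)[OF h(1-3)] word_perm_rev[of s] by (metis comp_apply id_apply)
  obtain t where t: "w = word_perm t \<circ> word_perm [a..<b + 1]" "distinct t"
      "set t = set s - {a..b}"
    using st(4) by (auto simp del: upt_Suc)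
  have "w' = word_perm t" using word_perm_comp_eqD'[OF h(6) t(1)] .
  then have bool: "boolean_perm n w'"
    using t h(2) by (intro boolean_permI[of t]) (auto simp: reduced_word_def is_word_def)
  from increasing.prems(1) show ?case
  proof (cases rule: canon_decomp.cases)
    case identity
    then show ?thesis using h by simp
  next
    case (single s2 a2 w2 rs2)
    have a: "a2 = a" using M[OF single(3) h(2)] single(4) h(3) by simp
    have "w (Suc a) = w (Suc b)"
      using single_step(1)[OF D[OF single(3)] single(2-5)] st(3) a by simp
    then show ?thesis using inj st(1) by blast
  next
    case (decreasing s2 a2 b2 w2 rs2)
    have a: "a2 = a" using M[OF decreasing(3) h(2)] decreasing(4) h(3) by simp
    show ?thesis
      using decreasing_step(1,2)[OF D[OF decreasing(3)] decreasing(2-6)] st a by simp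
  next
    case (increasing s2 a2 b2 w2 rs2)
    have a: "a2 = a" using M[OF increasing(3) h(2)] increasing(4) h(3) by simp
    have "w (Suc b2) = w (Suc b)"
      using increasing_step(3)[OF D[OF increasing(3)] increasing(2-6)] st(3) a by simp
    then have b: "b2 = b" using inj by blast
    have "w2 = w'" using word_perm_comp_eqD'[OF increasing(7)[unfolded a b] h(6)] .
    then show ?thesis using IH[OF _ bool] increasing a b by auto
  qed
qed

theorem canon_decomp_ex1:
  assumes "boolean_perm n w"
  shows "\<exists>!rs. canon_decomp n w rs"
proof -
  obtain s where "set s \<subseteq> {1..<n}" "distinct s" "w = word_perm s"
    using assms by (auto simp: boolean_perm_def reduced_word_def is_word_def)
  then show ?thesis using canon_decomp_ex canon_decomp_unique[OF _ _ assms] by blast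
qed

end

theory Submission
  imports Defs
begin

text \<open>
  If the entries bumped out of the first row, listed in the order of the insertions that bump
  them, form an increasing sequence, then each of them is appended at the end of the second row
  and there is no third row. The second row of the insertion tableau then consists of the bumped
  entries, and the second row of the recording tableau of the times at which they are bumped
  (\<open>Row2_rsk_of_increasing_bumps\<close>). So only the first row has to be followed.

  For a boolean permutation this is done along the recursion for the canonical word. Write \<open>a\<close> and
  \<open>b\<close> for the smallest and the largest letter of the run that is split off. The remaining
  permutation \<open>w'\<close> has letters above \<open>b\<close> only, so its one-line notation is $1 \cdots b$ followed by a
  rearrangement of $b+1, \ldots, n$.

  \<^item> Multiplication by $b(b-1) \cdots a$ on the left gives
    $w = 1 \cdots (a-1)\;(b+1)\;a \cdots (b-1)\;\cdots$, where the rest is the second part of \<open>w'\<close>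
    with the value $b+1$ lowered to $b$. At time $a+1$ the entry $b+1$ is bumped.

  \<^item> Multiplication by $a(a+1) \cdots b$ on the right gives
    $w = 1 \cdots (a-1)\;(a+1) \cdots b\;w'(b+1)\;a\;w'(b+2) \cdots w'(n)$. At time $b+1$ the
    entry $a+1$ is bumped. A run of a single letter commutes with \<open>w'\<close> and is the case \<open>a = b\<close>
    here, with \<open>w'(a + 1) = a + 1\<close>.

  After that the small entries of the first row never move again, and the same entries are bumped
  at the same times as in the insertion of \<open>w'\<close>. These entries exceed $b+1$, so the bumped entries
  stay increasing (\<open>bumps_decreasing_run\<close>, \<open>bumps_increasing_run\<close>). The new pair of
  time and bumped entry is the successor of the last and of the first letter of the run.
\<close>

section \<open>Bumping out of the first row\<close>

text \<open>
  The pairs (time, bumped entry) that arise when a word is inserted into the row \<open>r\<close>, starting at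
  time \<open>j\<close>.
\<close>

fun bumps :: "nat \<Rightarrow> nat list \<Rightarrow> nat list \<Rightarrow> (nat \<times> nat) list" where
  "bumps j r [] = []"
| "bumps j r (x # xs) =
     (case row_insert x r of
        (r', None) \<Rightarrow> bumps (Suc j) r' xs
      | (r', Some y) \<Rightarrow> (j, y) # bumps (Suc j) r' xs)"

lemma row_insert_append:
  "\<forall>y\<in>set u. y \<le> x \<Longrightarrow> row_insert x (u @ v) = map_prod ((@) u) id (row_insert x v)"
  by (induction u) (auto simp: case_prod_beta prod_eq_iff)

lemma row_insert_at_end: "\<forall>y\<in>set u. y \<le> x \<Longrightarrow> row_insert x u = (u @ [x], None)"
  using row_insert_append[of u x "[]"] by simp

lemma set_row_insert: "row_insert x r = (r', z) \<Longrightarrow> set r' \<subseteq> insert x (set r)"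
  by (induction r arbitrary: r') (auto split: if_splits prod.splits)

lemma bumped_gt: "row_insert x r = (r', Some y) \<Longrightarrow> x < y"
  by (induction r arbitrary: r') (auto split: if_splits prod.splits)

lemma row_insert_map:
  assumes "strict_mono_on A f" "x \<in> A" "set r \<subseteq> A"
  shows "row_insert (f x) (map f r) = map_prod (map f) (map_option f) (row_insert x r)"
  using assms by (induction r) (auto simp: case_prod_beta strict_mono_on_less)

lemma bumps_gt: "p \<in> set (bumps j r xs) \<Longrightarrow> \<exists>x\<in>set xs. x < snd p"
proof (induction xs arbitrary: j r)
  case (Cons x xs)
  obtain r' z where "row_insert x r = (r', z)" by fastforce
  then show ?case
    using Cons bumped_gt[of x r r'] by (cases z) auto
qed simp

text \<open>Entries that no later insertion can bump may be dropped from the row.\<close>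

lemma bumps_drop_prefix:
  assumes "\<forall>y\<in>set u. \<forall>x\<in>set xs. y \<le> x"
  shows "bumps j (u @ v) xs = bumps j v xs"
  using assms
  by (induction xs arbitrary: j v)
    (auto simp: row_insert_append split: prod.splits option.splits)

lemma bumps_append_sorted:
  assumes "sorted (u @ xs)"
  shows "bumps j u (xs @ ys) = bumps (j + length xs) (u @ xs) ys"
  using assms
proof (induction xs arbitrary: j u)
  case (Cons x xs)
  then have "row_insert x u = (u @ [x], None)"
    by (intro row_insert_at_end) (auto simp: sorted_append)
  then show ?case using Cons.IH[of "u @ [x]" "Suc j"] Cons.prems by simp
qed simp

lemma bumps_skip_sorted:
  assumes "sorted (u @ xs)" "\<forall>y\<in>set (u @ xs). \<forall>x\<in>set ys. y \<le> x"
  shows "bumps j u (xs @ ys) = bumps (j + length xs) [] ys"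
  using bumps_append_sorted[OF assms(1)] bumps_drop_prefix[OF assms(2), of _ "[]"] by simp

lemma bumps_map:
  assumes "strict_mono_on A f" "set r \<subseteq> A" "set xs \<subseteq> A"
  shows "bumps j (map f r) (map f xs) = map (apsnd f) (bumps j r xs)"
  using assms(2,3)
proof (induction xs arbitrary: j r)
  case (Cons x xs)
  obtain r' z where ins: "row_insert x r = (r', z)" by fastforce
  have "set r' \<subseteq> A" using set_row_insert[OF ins] Cons.prems by auto
  then show ?case
    using Cons row_insert_map[OF assms(1), of x r] ins by (auto split: option.splits)
qed simp


section \<open>The second row when the bumped entries increase\<close>

definition two_rows :: "nat list \<Rightarrow> nat list \<Rightarrow> tableau" where
  "two_rows r t = r # (if t = [] then [] else [t])"

lemma Row2_two_rows: "Row2 (two_rows r t) = set t"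
  by (simp add: Row2_def two_rows_def)

text \<open>
  Both tableaux are followed together: the list \<open>B\<close> of bumps so far is the second row of the
  insertion tableau and of the recording tableau at once.
\<close>

lemma rsk_two_rows:
  assumes "sorted_wrt (<) (map snd (B @ bumps j r xs))"
  shows "\<exists>r' q'. fold rsk_step (zip [j..<j + length xs] xs)
      (two_rows r (map snd B), two_rows q (map fst B)) =
      (two_rows r' (map snd (B @ bumps j r xs)), two_rows q' (map fst (B @ bumps j r xs)))"
  using assms
proof (induction xs arbitrary: j r q B)
  case (Cons x xs)
  have times: "[j..<j + length (x # xs)] = j # [Suc j..<Suc j + length xs]"
    by (simp add: upt_rec)
  obtain r' z where ins: "row_insert x r = (r', z)" by fastforce
  show ?case
  proof (cases z)
    case None
    have "rsk_step (j, x) (two_rows r (map snd B), two_rows q (map fst B)) =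
        (two_rows r' (map snd B), two_rows (q @ [j]) (map fst B))"
      using ins None by (simp add: rsk_step_def two_rows_def append_to_row_def)
    then show ?thesis
      using Cons.IH[of B "Suc j" r' "q @ [j]"] Cons.prems ins None unfolding times by simp
  next
    case (Some y)
    then have row: "\<forall>v\<in>set (map snd B). v \<le> y"
      using Cons.prems ins by (force simp: sorted_wrt_append)
    \<comment> \<open>The increase of the bumped entries puts \<open>y\<close> at the end of the second row.\<close>
    have "rsk_step (j, x) (two_rows r (map snd B), two_rows q (map fst B)) =
        (two_rows r' (map snd (B @ [(j, y)])), two_rows q (map fst (B @ [(j, y)])))"
      using ins Some row_insert_at_end[OF row]
      by (simp add: rsk_step_def two_rows_def append_to_row_def)
    then show ?thesis
      using Cons.IH[of "B @ [(j, y)]" "Suc j" r' q] Cons.prems ins Some unfolding times by simp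
  qed
qed auto

lemma Row2_rsk_of_increasing_bumps:
  assumes "sorted_wrt (<) (map snd (bumps 1 [] xs))"
  shows "Row2 (fst (rsk xs)) = snd ` set (bumps 1 [] xs)"
    "Row2 (snd (rsk xs)) = fst ` set (bumps 1 [] xs)"
proof -
  have "Row2 (fst (rsk xs)) = snd ` set (bumps 1 [] xs) \<and>
      Row2 (snd (rsk xs)) = fst ` set (bumps 1 [] xs)"
  proof (cases xs)
    case Nil
    then show ?thesis by (simp add: rsk_def Row2_def)
  next
    case (Cons x ys)
    have "zip [1..<length xs + 1] xs = (1, x) # zip [2..<length xs + 1] ys"
      using Cons by (simp add: upt_rec numeral_2_eq_2)
    \<comment> \<open>Starting from one empty row instead of no row makes no difference to a nonempty word.\<close>
    then have "rsk xs = fold rsk_step (zip [1..<1 + length xs] xs)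
        (two_rows [] (map snd []), two_rows [] (map fst []))"
      by (simp add: rsk_def two_rows_def rsk_step_def append_to_row_def)
    then obtain r q where "rsk xs =
        (two_rows r (map snd (bumps 1 [] xs)), two_rows q (map fst (bumps 1 [] xs)))"
      using rsk_two_rows[of "[]" 1 "[]" xs "[]"] assms by auto
    then show ?thesis by (simp add: Row2_two_rows)
  qed
  then show "Row2 (fst (rsk xs)) = snd ` set (bumps 1 [] xs)"
    "Row2 (snd (rsk xs)) = fst ` set (bumps 1 [] xs)" by blast+
qed


section \<open>The effect of one run\<close>

lemma word_perm_decreasing_run_apply:
  "a \<le> b \<Longrightarrow> word_perm (rev [a..<Suc b]) x =
     (if x = a then Suc b else if a < x \<and> x \<le> Suc b then x - 1 else x)"
  by (induction b rule: dec_induct) (auto simp: transpose_def)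

lemma word_perm_increasing_run_apply:
  assumes "a \<le> b"
  shows "word_perm [a..<Suc b] x =
     (if x = Suc b then a else if a \<le> x \<and> x \<le> b then Suc x else x)"
proof -
  define y where "y = (if x = Suc b then a else if a \<le> x \<and> x \<le> b then Suc x else x)"
  have "word_perm (rev [a..<Suc b]) y = x"
    using assms by (auto simp: y_def word_perm_decreasing_run_apply simp del: upt_Suc)
  then show ?thesis
    using fun_cong[OF word_perm_rev'[of "[a..<Suc b]"], of y] by (simp add: y_def del: upt_Suc)
qed

lemma upt_split_at: "i \<le> j \<Longrightarrow> j \<le> k \<Longrightarrow> [i..<k] = [i..<j] @ [j..<k]"
  using upt_add_eq_append[of i j "k - j"] by simp

text \<open>The fixed points \<open>1..b\<close> at the start have no effect on the bumping.\<close>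

lemma bumps_one_line_fixed_prefix:
  assumes "b < n" "\<forall>i\<le>b. w i = i" "\<forall>i>b. b < w i"
  shows "bumps 1 [] (one_line n w) = bumps (Suc b) [] (map w [Suc b..<Suc n])"
proof -
  have "[1..<n + 1] = [1..<Suc b] @ [Suc b..<Suc n]"
    using assms(1) upt_split_at[of 1 "Suc b" "Suc n"] by simp
  then have "one_line n w = [1..<Suc b] @ map w [Suc b..<Suc n]"
    using assms(2) map_idI[of "[1..<Suc b]" w]
    by (simp add: one_line_def del: upt_Suc One_nat_def)
  moreover have "bumps 1 [] ([1..<Suc b] @ map w [Suc b..<Suc n]) =
      bumps (1 + length [1..<Suc b]) [] (map w [Suc b..<Suc n])"
    using assms(3) by (intro bumps_skip_sorted) (auto simp: less_Suc_eq_le Suc_le_eq simp del: upt_Suc intro: less_imp_le order_le_less_trans)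
  ultimately show ?thesis by (simp add: plus_1_eq_Suc del: upt_Suc One_nat_def)
qed

text \<open>
  Lowering the value $b+1$ to $b$ keeps the relative order of the values above $b$, and $b+1$, the
  smallest of them, is never bumped.
\<close>

lemma bumps_decreasing_run:
  assumes "0 < a" "a < b" "b < n" "\<forall>i\<le>b. w' i = i" "\<forall>i>b. b < w' i"
    "w = word_perm (rev [a..<Suc b]) \<circ> w'"
  shows "bumps 1 [] (one_line n w) = (Suc a, Suc b) # bumps 1 [] (one_line n w')"
proof -
  define f where "f = (\<lambda>x. if x = Suc b then b else x)"
  define zs where "zs = map w' [Suc b..<Suc n]"
  have zs: "set zs \<subseteq> {b<..}" using assms(5) by (auto simp: zs_def)
  have w: "w i = (if w' i = a then Suc b else if a < w' i \<and> w' i \<le> Suc b then w' i - 1 else w' i)" for i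
    using assms by (simp add: word_perm_decreasing_run_apply del: upt_Suc)
  have "\<forall>i\<le>a - 1. w i = i" "\<forall>i>a - 1. a - 1 < w i"
  proof -
    show "\<forall>i\<le>a - 1. w i = i" using w assms(1,2,4) by auto
    show "\<forall>i>a - 1. a - 1 < w i"
    proof (intro allI impI)
      fix i assume "a - 1 < i"
      moreover have "i \<le> b \<and> w' i = i \<or> b < w' i" using assms(4,5) not_le by blast
      ultimately show "a - 1 < w i" using w[of i] assms(1,2) by (auto split: if_splits)
    qed
  qed
  then have "bumps 1 [] (one_line n w) = bumps a [] (map w [a..<Suc n])"
    using bumps_one_line_fixed_prefix[of "a - 1" n w] assms by simp
  also have "[a..<Suc n] = a # Suc a # [Suc (Suc a)..<Suc b] @ [Suc b..<Suc n]"
    using assms upt_split_at[of "Suc (Suc a)" "Suc b" "Suc n"] by (simp add: upt_conv_Cons del: upt_Suc)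
  also have "map w \<dots> = Suc b # a # [Suc a..<b] @ map f zs"
  proof -
    have "map w [Suc (Suc a)..<Suc b] = [Suc a..<b]"
      using assms(1-4) by (intro nth_equalityI) (auto simp: w simp del: upt_Suc)
    moreover have "map w [Suc b..<Suc n] = map f zs"
    proof -
      have "w i = f (w' i)" if "b < i" for i
      proof -
        have "b < w' i" using assms(5) that by blast
        then show ?thesis using w[of i] assms(2) by (auto simp: f_def)
      qed
      then show ?thesis by (simp add: zs_def del: upt_Suc)
    qed
    ultimately show ?thesis using assms(1-4) by (simp add: w del: upt_Suc)
  qed
  also have "bumps a [] \<dots> = (Suc a, Suc b) # bumps (Suc (Suc a)) [a] ([Suc a..<b] @ map f zs)"
    using assms by simp
  also have "bumps (Suc (Suc a)) [a] ([Suc a..<b] @ map f zs) =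
      bumps (Suc (Suc a) + length [Suc a..<b]) [] (map f zs)"
    using assms(1,2) zs by (intro bumps_skip_sorted) (auto simp: f_def less_imp_le)
  also have "\<dots> = bumps (Suc b) [] (map f zs)" using assms by simp
  also have "\<dots> = map (apsnd f) (bumps (Suc b) [] zs)"
    using bumps_map[of "{b<..}" f "[]" zs] zs by (auto simp: strict_mono_on_def f_def)
  also have "\<dots> = bumps (Suc b) [] zs"
  proof (rule map_idI)
    fix p assume "p \<in> set (bumps (Suc b) [] zs)"
    from bumps_gt[OF this] have "Suc b < snd p" using zs by fastforce
    then show "apsnd f p = p" by (cases p) (simp add: f_def)
  qed
  also have "\<dots> = bumps 1 [] (one_line n w')"
    using assms zs_def bumps_one_line_fixed_prefix by simp
  finally show ?thesis .
qed

text \<open>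
  When \<open>a\<close> is inserted, the first row ends in $a+1, \ldots, b, w'(b+1)$. For \<open>a < b\<close> the entry
  $a+1$ of the run is bumped. A run of a single letter \<open>a = b\<close> is admitted when
  \<open>w'\<close> fixes $a+1$, because then the entry that \<open>a\<close> bumps is again $a+1$.
\<close>

lemma bumps_increasing_run:
  assumes "0 < a" "a \<le> b" "b < n" "\<forall>i\<le>b. w' i = i" "a < b \<or> w' (Suc b) = Suc b" "\<forall>i>b. b < w' i"
    "w = w' \<circ> word_perm [a..<Suc b]"
  shows "bumps 1 [] (one_line n w) = (Suc b, Suc a) # bumps 1 [] (one_line n w')"
proof -
  define c where "c = w' (Suc b)"
  define zs where "zs = map w' [Suc (Suc b)..<Suc n]"
  have c: "b < c" using assms(6) by (auto simp: c_def)
  have zs: "\<forall>z\<in>set zs. b < z" using assms(6) by (auto simp: zs_def)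
  have w: "w i = w' (if i = Suc b then a else if a \<le> i \<and> i \<le> b then Suc i else i)" for i
    using assms by (simp add: word_perm_increasing_run_apply del: upt_Suc)
  have "\<forall>i\<le>a - 1. w i = i" "\<forall>i>a - 1. a - 1 < w i"
  proof -
    show "\<forall>i\<le>a - 1. w i = i" using w assms(1,2,4) by auto
    show "\<forall>i>a - 1. a - 1 < w i"
    proof (intro allI impI)
      fix i assume "a - 1 < i"
      moreover have "b \<le> w' (Suc b)" using c by (simp add: c_def)
      moreover have "i \<le> b \<or> b < w' i" using assms(6) not_le by blast
      ultimately show "a - 1 < w i"
        using w[of i] assms(1,2,4) by (cases "i < b"; cases "i = b") auto
    qed
  qed
  then have "bumps 1 [] (one_line n w) = bumps a [] (map w [a..<Suc n])"
    using bumps_one_line_fixed_prefix[of "a - 1" n w] assms by simp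
  also have "[a..<Suc n] = [a..<b] @ b # Suc b # [Suc (Suc b)..<Suc n]"
    using assms upt_split_at[of a b "Suc n"] by (simp add: upt_conv_Cons del: upt_Suc)
  also have "map w \<dots> = ([Suc a..<Suc b] @ [c]) @ a # zs"
  proof -
    have "map w [a..<b] = [Suc a..<Suc b]"
      using assms(1-4) by (intro nth_equalityI) (auto simp: w simp del: upt_Suc)
    then show ?thesis using assms(1-4) by (simp add: w c_def zs_def del: upt_Suc)
  qed
  also have "bumps a [] \<dots> = bumps (a + length ([Suc a..<Suc b] @ [c])) ([] @ [Suc a..<Suc b] @ [c]) (a # zs)"
    using c by (intro bumps_append_sorted) (auto simp: sorted_append simp del: upt_Suc)
  also have "\<dots> = bumps (Suc b) ([Suc a..<Suc b] @ [c]) (a # zs)"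
    using assms(2) by (simp del: upt_Suc)
  also have "\<dots> = (Suc b, Suc a) # bumps (Suc (Suc b)) [c] zs"
  proof (cases "a < b")
    case True
    have "bumps (Suc (Suc b)) ((a # [Suc (Suc a)..<Suc b]) @ [c]) zs = bumps (Suc (Suc b)) [c] zs"
      using zs True by (intro bumps_drop_prefix) (force simp del: upt_Suc)
    then show ?thesis using True by (simp add: upt_conv_Cons del: upt_Suc)
  next
    case False
    then have "a = b" "c = Suc a" using assms by (auto simp: c_def)
    moreover have "bumps (Suc (Suc b)) ([a] @ []) zs = bumps (Suc (Suc b)) [] zs"
      using zs \<open>a = b\<close> by (intro bumps_drop_prefix) (auto simp: less_imp_le)
    moreover have "bumps (Suc (Suc b)) ([c] @ []) zs = bumps (Suc (Suc b)) [] zs"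
      using zs \<open>a = b\<close> \<open>c = Suc a\<close> by (intro bumps_drop_prefix) (auto simp: Suc_le_eq)
    ultimately show ?thesis by simp
  qed
  also have "bumps (Suc (Suc b)) [c] zs = bumps (Suc b) [] (c # zs)" by simp
  also have "c # zs = map w' [Suc b..<Suc n]"
    using assms by (simp add: c_def zs_def upt_conv_Cons del: upt_Suc)
  also have "bumps (Suc b) [] \<dots> = bumps 1 [] (one_line n w')"
    using assms bumps_one_line_fixed_prefix by simp
  finally show ?thesis .
qed


section \<open>Induction along the canonical decomposition\<close>

lemma bumps_gt_fixed_prefix:
  assumes "b < n" "\<forall>i\<le>b. w i = i" "\<forall>i>b. b < w i" "p \<in> set (bumps 1 [] (one_line n w))"
  shows "Suc b < snd p"
proof -
  have "p \<in> set (bumps (Suc b) [] (map w [Suc b..<Suc n]))"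
    using assms bumps_one_line_fixed_prefix by simp
  from bumps_gt[OF this] obtain i where "i \<in> set [Suc b..<Suc n]" "w i < snd p"
    by (auto simp del: upt_Suc)
  moreover from this have "b < w i" using assms(3) by (simp del: upt_Suc)
  ultimately show ?thesis by simp
qed

lemma word_perm_letters_above:
  assumes "\<forall>i\<in>set t. b < i"
  shows "\<forall>i\<le>b. word_perm t i = i" "\<forall>i>b. b < word_perm t i"
proof -
  show "\<forall>i\<le>b. word_perm t i = i" using assms by (auto intro!: word_perm_fix)
  have "b \<notin> set t" using assms by auto
  then show "\<forall>i>b. b < word_perm t i" using word_perm_le[of b t] by (meson not_le)
qed

lemma bumps_canon_decomp:
  assumes "canon_decomp n w rs" "boolean_perm n w"
  shows "sorted_wrt (<) (map snd (bumps 1 [] (one_line n w))) \<and>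
    set (bumps 1 [] (one_line n w)) = (\<lambda>r. (Suc (last r), Suc (hd r))) ` set rs"
  using assms
proof (induction rule: canon_decomp.induct)
  case identity
  have "bumps 1 [] ([1..<n + 1] @ []) = []"
    by (subst bumps_skip_sorted) (auto simp del: upt_Suc)
  then show ?case by (simp add: one_line_def del: upt_Suc)
next
  case (single w s a w' rs)
  note h = single.hyps and m = min_letter[OF single.hyps(1-3)]
  have d: "distinct s" using reduced_word_distinct single.prems h(2) by blast
  obtain t where t: "w = word_perm [a] \<circ> word_perm t" "distinct t" "set t = set s - {a}"
    using single_step(2)[OF d h(1-4)] by blast
  have w': "w' = word_perm t" using word_perm_comp_eqD[OF h(5) t(1)] .
  have above: "\<forall>i\<in>set t. a < i" using t(3) m(2) by force
  note fix' = word_perm_letters_above[OF above]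
  have "a - 1 \<notin> set t" "a \<notin> set t" "Suc a \<notin> set t" using t(3) m(6) h(4) by auto
  \<comment> \<open>An isolated letter commutes with the rest, so it may as well be an increasing run.\<close>
  then have "w = w' \<circ> word_perm [a..<Suc a]"
    using word_perm_transpose_commute[of a t] t(1) w' by simp
  moreover have "w' (Suc a) = Suc a"
    unfolding w' using t(3) h(4) by (intro word_perm_fix) auto
  moreover have "a < n" using m(1,4) by auto
  ultimately have eq: "bumps 1 [] (one_line n w) = (Suc a, Suc a) # bumps 1 [] (one_line n w')"
    using bumps_increasing_run[of a a n w' w] m(3) fix' w' by simp
  have "boolean_perm n w'" using t m(4) w' by (intro boolean_permI[of t]) auto
  then show ?case
    using single.IH bumps_gt_fixed_prefix[OF \<open>a < n\<close> fix'] by (auto simp: eq w' simp del: One_nat_def)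
next
  case (decreasing w s a b w' rs)
  note h = decreasing.hyps and m = min_letter[OF decreasing.hyps(1-3)]
  have d: "distinct s" using reduced_word_distinct decreasing.prems h(2) by blast
  note st = decreasing_step[OF d h(1-5)]
  obtain t where t: "w = word_perm (rev [a..<b + 1]) \<circ> word_perm t" "distinct t" "set t = set s - {a..b}"
    using st(3) by (auto simp del: upt_Suc)
  have w': "w' = word_perm t" using word_perm_comp_eqD[OF h(6) t(1)] .
  have above: "\<forall>i\<in>set t. b < i" using t(3) m(2) by force
  note fix' = word_perm_letters_above[OF above]
  have "b \<in> set s"
    using list_emb_set[OF greatest_decreasing(2)[OF d h(4,5)], of b] st(1) by auto
  then have "b < n" using m(4) by auto
  then have eq: "bumps 1 [] (one_line n w) = (Suc a, Suc b) # bumps 1 [] (one_line n w')"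
    using bumps_decreasing_run[of a b n w' w] m(3) fix' w' st(1) h(6) by simp
  have ends: "hd (rev [a..<b + 1]) = b" "last (rev [a..<b + 1]) = a"
    using st(1) by (simp_all add: hd_rev last_rev)
  have "boolean_perm n w'" using t m(4) w' by (intro boolean_permI[of t]) auto
  then show ?case
    using decreasing.IH bumps_gt_fixed_prefix[OF \<open>b < n\<close> fix']
    by (auto simp: eq w' ends simp del: upt_Suc One_nat_def)
next
  case (increasing w s a b w' rs)
  note h = increasing.hyps and m = min_letter[OF increasing.hyps(1-3)]
  have d: "distinct s" using reduced_word_distinct increasing.prems h(2) by blast
  note st = increasing_step[OF d h(1-5)]
  obtain t where t: "w = word_perm t \<circ> word_perm [a..<b + 1]" "distinct t" "set t = set s - {a..b}"
    using st(4) by (auto simp del: upt_Suc)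
  have w': "w' = word_perm t" using word_perm_comp_eqD'[OF h(6) t(1)] .
  have above: "\<forall>i\<in>set t. b < i" using t(3) m(2) by force
  note fix' = word_perm_letters_above[OF above]
  have "b \<in> set s"
    using list_emb_set[OF greatest_increasing(2)[OF d h(4,5)], of b] st(1) by auto
  then have "b < n" using m(4) by auto
  then have eq: "bumps 1 [] (one_line n w) = (Suc b, Suc a) # bumps 1 [] (one_line n w')"
    using bumps_increasing_run[of a b n w' w] m(3) fix' w' st(1) h(6) by simp
  have ends: "hd [a..<b + 1] = a" "last [a..<b + 1] = b"
    using st(1) by (simp_all add: hd_append)
  have "boolean_perm n w'" using t m(4) w' by (intro boolean_permI[of t]) auto
  moreover have "Suc a < snd p" if "p \<in> set (bumps 1 [] (one_line n w'))" for p
    using bumps_gt_fixed_prefix[OF \<open>b < n\<close> fix', of p] that st(1) w'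
    by (simp del: One_nat_def)
  ultimately show ?case
    using increasing.IH by (auto simp: eq w' ends simp del: upt_Suc One_nat_def)
qed

theorem theorem4p5:
  fixes n :: nat and w :: "nat \<Rightarrow> nat"
  assumes "w permutes {1..n}" and "boolean_perm n w"
  shows "Row2 (P_tableau n w) = {hd r + 1 | r. r \<in> set (canon_runs n w)} \<and>
    Row2 (Q_tableau n w) = {last r + 1 | r. r \<in> set (canon_runs n w)}"
proof -
  have "canon_decomp n w (canon_runs n w)"
    unfolding canon_runs_def by (rule theI'[OF canon_decomp_ex1[OF assms(2)]])
  note bumps = bumps_canon_decomp[OF this assms(2)]
  then show ?thesis
    using Row2_rsk_of_increasing_bumps[OF conjunct1[OF bumps]]
    by (auto simp: P_tableau_def Q_tableau_def image_image)
qed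

end
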